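(* Let $(X,\mathcal{V})$ be a semi-coarse space, let $A\subset X$, let $*\in A$ be a base point, and let $n\in\mathbb{N}$. Then: (1) if $n\geq 1$, then $(\pi_n^{sc}(X,* ),\star)$ is a group; (2) if $n\geq 2$, then $(\pi_n^{sc}(X,* ),\star)$ is an abelian group; (3) if $n\geq 2$, then $(\pi_n^{sc}(X,A,* ),\star)$ is a group; (4) if $n\geq 3$, then $(\pi_n^{sc}(X,A,* ),\star)$ is an abelian group.
   Context: Semi-coarse spaces. For $V\subset X\times X$ put $V^{-1}=\{(y,x):(x,y)\in V\}$, and let $\Delta_X$ be the diagonal. A semi-coarse structure on a set $X$ is a collection $\mathcal{V}$ of subsets of $X\times X$ (the controlled sets) with $\Delta_X\in\mathcal{V}$ that is closed under taking subsets, finite unions and inverses $V\mapsto V^{-1}$; $(X,\mathcal{V})$ is a semi-coarse space. A map $f:(X,\mathcal{V})\to(Y,\mathcal{W})$ is bornologous if $(f\times f)(V)\in\mathcal{W}$ for all $V\in\mathcal{V}$. A subset $Y\subset X$ carries the subspace structure $\{V\cap(Y\times Y):V\in\mathcal{V}\}$. The product structure $\mathcal{V}\times\mathcal{W}$ on $X\times Y$ consists of all subsets of finite unions of sets $V\boxtimes W=\{((a,b),(c,d)):(a,c)\in V,(b,d)\in W\}$ with $V\in\mathcal{V}$, $W\in\mathcal{W}$. $\mathbb{Z}$ carries the structure $\mathcal{Z}$ of all subsets of $\{(a,b)\in\mathbb{Z}^2:|a-b|\leq 1\}$. For an integer $m\ge 1$, $I_m=\{0,1,\dots,m\}$ has the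 subspace structure from $(\mathbb{Z},\mathcal{Z})$ and $I_m^n$ the $n$-fold product structure (i.e. all sets of pairs $(x,y)$ with $|x_i-y_i|\le 1$ for all $i$). Put $\partial I_m^n=\{x\in I_m^n:\exists i,\ x_i\in\{0,m\}\}$ and $J_m^{n-1}=\{x\in\partial I_m^n:\text{ if }x_n=0\text{ then }\exists i\neq n\text{ with }x_i\in\{0,m\}\}$. For $B\subset A\subset X$, $D\subset C\subset Y$, a bornologous map of triples $f:(X,A,B)\to(Y,C,D)$ is a bornologous map $X\to Y$ with $f(A)\subset C$, $f(B)\subset D$. Two such maps $f,g$ are homotopic, $f\simeq_{sc}g$, if there are a bornologous $H:(X\times\mathbb{Z},\mathcal{V}\times\mathcal{Z})\to(Y,\mathcal{W})$ and integers $M<N$ with $H(x,k)=f(x)$ for $k\le M$, $H(x,k)=g(x)$ for $k\ge N$, $H(A\times\mathbb{Z})\subset C$ and $H(B\times\mathbb{Z})\subset D$; this is an equivalence relation. For $m<m'$ let $\phi_m^{m'}:I_{m'}^n\to I_m^n$ be the map replacing each coordinate $x_k$ by $\min(x_k,m)$. Precomposition with $\phi_m^{m'}$ induces maps $i_m^{m'}$ from the set $[(I_m^n,\partial I_m^n,J_m^{n-1}),(X,A,* )]$ of homotopy classes of bornologous maps of triples (writing $*$ for $\{*\}$) to the corresponding set for $m'$, giving a directed system. For $n\ge1$, $\pi_n^{sc}(X,A,* )$ is the direct limit of this system of sets, and $\langle f\rangle$ is the class of $f$. Put $\pi_n^{sc}(X,* )=\pi_n^{sc}(X,\{*\},* )$.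 Operation: for $f$ defined on $I_m^n$ and $g$ on $I_{m'}^n$, define $f\star g$ on $I_{m+m'}^n$ by $(f\star g)(\alpha)=f(\phi_m^{m+m'}(\alpha))$ if $0\le\alpha_1\le m$ and $(f\star g)(\alpha)=g(\phi_{m'}^{m+m'}(\alpha-me_1))$ if $m<\alpha_1\le m+m'$, where $e_1=(1,0,\dots,0)$. On classes, $\langle f\rangle\star\langle g\rangle=\langle f\star g\rangle$; this is well defined on $\pi_n^{sc}(X,* )$ for $n\ge1$ and on $\pi_n^{sc}(X,A,* )$ for $n\geq 2$. *)

theory Defs
  imports "HOL-Algebra.Group"
begin

section \<open>Semi-coarse spaces\<close>

locale semi_coarse_space =
  fixes X :: "'a set" and \<V> :: "('a \<times> 'a) set set"
  assumes controlled_subset: "V \<in> \<V> \<Longrightarrow> V \<subseteq> X \<times> X"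
    and diagonal: "Id_on X \<in> \<V>"
    and subset_closed: "V \<in> \<V> \<Longrightarrow> U \<subseteq> V \<Longrightarrow> U \<in> \<V>"
    and finite_Union_closed: "finite F \<Longrightarrow> F \<subseteq> \<V> \<Longrightarrow> \<Union> F \<in> \<V>"
    and inverse_closed: "V \<in> \<V> \<Longrightarrow> V\<inverse> \<in> \<V>"

definition bornologous ::
  "'a set \<Rightarrow> ('a \<times> 'a) set set \<Rightarrow> 'b set \<Rightarrow> ('b \<times> 'b) set set \<Rightarrow> ('a \<Rightarrow> 'b) \<Rightarrow> bool" where
  "bornologous X \<V> Y \<W> f \<longleftrightarrow> f \<in> X \<rightarrow> Y \<and> (\<forall>V\<in>\<V>. map_prod f f ` V \<in> \<W>)"

definition sc_subspace :: "('a \<times> 'a) set set \<Rightarrow> 'a set \<Rightarrow> ('a \<times> 'a) set set" where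
  "sc_subspace \<V> Y = {V \<inter> Y \<times> Y | V. V \<in> \<V>}"

definition box2 :: "('a \<times> 'a) set \<Rightarrow> ('b \<times> 'b) set \<Rightarrow> (('a \<times> 'b) \<times> ('a \<times> 'b)) set" where
  "box2 V W = {((a, b), (c, d)) | a b c d. (a, c) \<in> V \<and> (b, d) \<in> W}"

definition sc_prod ::
  "('a \<times> 'a) set set \<Rightarrow> ('b \<times> 'b) set set \<Rightarrow> (('a \<times> 'b) \<times> ('a \<times> 'b)) set set" where
  "sc_prod \<V> \<W> = {U. \<exists>F. finite F \<and> F \<subseteq> {box2 V W | V W. V \<in> \<V> \<and> W \<in> \<W>} \<and> U \<subseteq> \<Union> F}"

text \<open>The same construction for a family of structures indexed by a finite set \<open>I\<close>; points of the
  product are functions that are \<open>undefined\<close> outside \<open>I\<close>.\<close>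

definition boxI :: "'i set \<Rightarrow> ('i \<Rightarrow> ('a \<times> 'a) set) \<Rightarrow> (('i \<Rightarrow> 'a) \<times> ('i \<Rightarrow> 'a)) set" where
  "boxI I V = {(x, y). x \<in> extensional I \<and> y \<in> extensional I \<and> (\<forall>i\<in>I. (x i, y i) \<in> V i)}"

definition sc_PiE ::
  "'i set \<Rightarrow> ('i \<Rightarrow> ('a \<times> 'a) set set) \<Rightarrow> (('i \<Rightarrow> 'a) \<times> ('i \<Rightarrow> 'a)) set set" where
  "sc_PiE I \<V> = {U. \<exists>F. finite F \<and> F \<subseteq> {boxI I V | V. \<forall>i\<in>I. V i \<in> \<V> i} \<and> U \<subseteq> \<Union> F}"

definition int_sc :: "(int \<times> int) set set" where
  "int_sc = Pow {(a, b). \<bar>a - b\<bar> \<le> 1}"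


section \<open>Maps of triples and their homotopies\<close>

text \<open>Maps are extensional, so that equality of maps is equality on the domain.\<close>

definition triple_maps ::
  "'a set \<Rightarrow> ('a \<times> 'a) set set \<Rightarrow> 'a set \<Rightarrow> 'a set \<Rightarrow>
   'b set \<Rightarrow> ('b \<times> 'b) set set \<Rightarrow> 'b set \<Rightarrow> 'b set \<Rightarrow> ('a \<Rightarrow> 'b) set" where
  "triple_maps X \<V> A B Y \<W> C D =
     {f \<in> X \<rightarrow>\<^sub>E Y. bornologous X \<V> Y \<W> f \<and> f ` A \<subseteq> C \<and> f ` B \<subseteq> D}"

definition triple_homotopy ::
  "'a set \<Rightarrow> ('a \<times> 'a) set set \<Rightarrow> 'a set \<Rightarrow> 'a set \<Rightarrow>
   'b set \<Rightarrow> ('b \<times> 'b) set set \<Rightarrow> 'b set \<Rightarrow> 'b set \<Rightarrow> (('a \<Rightarrow> 'b) \<times> ('a \<Rightarrow> 'b)) set" where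
  "triple_homotopy X \<V> A B Y \<W> C D =
     {(f, g). f \<in> triple_maps X \<V> A B Y \<W> C D \<and> g \<in> triple_maps X \<V> A B Y \<W> C D \<and>
        (\<exists>H M N. bornologous (X \<times> UNIV) (sc_prod \<V> int_sc) Y \<W> H \<and> M < N \<and>
           (\<forall>x\<in>X. \<forall>k\<le>M. H (x, k) = f x) \<and> (\<forall>x\<in>X. \<forall>k\<ge>N. H (x, k) = g x) \<and>
           H ` (A \<times> UNIV) \<subseteq> C \<and> H ` (B \<times> UNIV) \<subseteq> D)}"


section \<open>Cubes\<close>

definition cube :: "nat \<Rightarrow> nat \<Rightarrow> (nat \<Rightarrow> int) set" where
  "cube n m = {1..n} \<rightarrow>\<^sub>E {0..int m}"

definition cube_sc :: "nat \<Rightarrow> nat \<Rightarrow> ((nat \<Rightarrow> int) \<times> (nat \<Rightarrow> int)) set set" where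
  "cube_sc n m = sc_PiE {1..n} (\<lambda>_. sc_subspace int_sc {0..int m})"

lemma cube_sc_eq:
  "cube_sc n m = Pow {(x, y). x \<in> cube n m \<and> y \<in> cube n m \<and> (\<forall>i\<in>{1..n}. \<bar>x i - y i\<bar> \<le> 1)}"
  (is "_ = Pow ?E")
proof (intro equalityI subsetI)
  fix U assume "U \<in> cube_sc n m"
  then obtain F where F: "U \<subseteq> \<Union> F"
    "F \<subseteq> {boxI {1..n} V | V. \<forall>i\<in>{1..n}. V i \<in> sc_subspace int_sc {0..int m}}"
    unfolding cube_sc_def sc_PiE_def by blast
  have "\<Union> F \<subseteq> ?E"
  proof
    fix p assume "p \<in> \<Union> F"
    then obtain V where V: "\<forall>i\<in>{1..n}. V i \<in> sc_subspace int_sc {0..int m}"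
      "p \<in> boxI {1..n} V" using F(2) by blast
    obtain x y where p: "p = (x, y)" by fastforce
    have ext: "x \<in> extensional {1..n}" "y \<in> extensional {1..n}"
      using V(2) unfolding p boxI_def by auto
    have "x i \<in> {0..int m} \<and> y i \<in> {0..int m} \<and> \<bar>x i - y i\<bar> \<le> 1" if i: "i \<in> {1..n}" for i
    proof -
      have "(x i, y i) \<in> V i" using V(2) i unfolding p boxI_def by blast
      then show ?thesis using V(1) i unfolding sc_subspace_def int_sc_def by fastforce
    qed
    then show "p \<in> ?E" using ext unfolding p cube_def PiE_def Pi_def by blast
  qed
  then show "U \<in> Pow ?E" using F(1) by blast
next
  fix U assume U: "U \<in> Pow ?E"
  define D where "D = {(a::int, b). \<bar>a - b\<bar> \<le> 1} \<inter> {0..int m} \<times> {0..int m}"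
  have D: "D \<in> sc_subspace int_sc {0..int m}"
    unfolding D_def sc_subspace_def int_sc_def by blast
  have "U \<subseteq> boxI {1..n} (\<lambda>_. D)"
    using U unfolding boxI_def D_def cube_def PiE_def Pi_def by fastforce
  then show "U \<in> cube_sc n m"
    using D unfolding cube_sc_def sc_PiE_def
    by (intro CollectI exI[of _ "{boxI {1..n} (\<lambda>_. D)}"]) auto
qed

definition cube_boundary :: "nat \<Rightarrow> nat \<Rightarrow> (nat \<Rightarrow> int) set" where
  "cube_boundary n m = {x \<in> cube n m. \<exists>i\<in>{1..n}. x i \<in> {0, int m}}"

definition cube_J :: "nat \<Rightarrow> nat \<Rightarrow> (nat \<Rightarrow> int) set" where
  "cube_J n m = {x \<in> cube_boundary n m. x n = 0 \<longrightarrow> (\<exists>i\<in>{1..n} - {n}. x i \<in> {0, int m})}"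

text \<open>\<open>truncate n m\<close> is the map \<open>\<phi>\<close> into \<open>cube n m\<close>; the larger cube it starts from enters only
  through the domain of the composition in \<open>cube_extend\<close>.\<close>

definition truncate :: "nat \<Rightarrow> nat \<Rightarrow> (nat \<Rightarrow> int) \<Rightarrow> (nat \<Rightarrow> int)" where
  "truncate n m x = (\<lambda>i\<in>{1..n}. min (x i) (int m))"

definition cube_extend :: "nat \<Rightarrow> nat \<Rightarrow> nat \<Rightarrow> ((nat \<Rightarrow> int) \<Rightarrow> 'a) \<Rightarrow> ((nat \<Rightarrow> int) \<Rightarrow> 'a)" where
  "cube_extend n m m' f = compose (cube n m') f (truncate n m)"

definition cube_star ::
  "nat \<Rightarrow> nat \<Rightarrow> nat \<Rightarrow> ((nat \<Rightarrow> int) \<Rightarrow> 'a) \<Rightarrow> ((nat \<Rightarrow> int) \<Rightarrow> 'a) \<Rightarrow> ((nat \<Rightarrow> int) \<Rightarrow> 'a)" where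
  "cube_star n m m' f g = (\<lambda>\<alpha>\<in>cube n (m + m').
     if \<alpha> 1 \<le> int m then f (truncate n m \<alpha>) else g (truncate n m' (\<alpha>(1 := \<alpha> 1 - int m))))"

definition cube_maps ::
  "nat \<Rightarrow> 'a set \<Rightarrow> ('a \<times> 'a) set set \<Rightarrow> 'a set \<Rightarrow> 'a \<Rightarrow> nat \<Rightarrow> ((nat \<Rightarrow> int) \<Rightarrow> 'a) set" where
  "cube_maps n X \<V> A pt m =
     triple_maps (cube n m) (cube_sc n m) (cube_boundary n m) (cube_J n m) X \<V> A {pt}"

definition cube_homotopy ::
  "nat \<Rightarrow> 'a set \<Rightarrow> ('a \<times> 'a) set set \<Rightarrow> 'a set \<Rightarrow> 'a \<Rightarrow> nat \<Rightarrow>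
   (((nat \<Rightarrow> int) \<Rightarrow> 'a) \<times> ((nat \<Rightarrow> int) \<Rightarrow> 'a)) set" where
  "cube_homotopy n X \<V> A pt m =
     triple_homotopy (cube n m) (cube_sc n m) (cube_boundary n m) (cube_J n m) X \<V> A {pt}"


section \<open>Homotopy groups\<close>

definition direct_limit_rel ::
  "'i::order set \<Rightarrow> ('i \<Rightarrow> 's set) \<Rightarrow> ('i \<Rightarrow> 'i \<Rightarrow> 's \<Rightarrow> 's) \<Rightarrow> (('i \<times> 's) \<times> ('i \<times> 's)) set" where
  "direct_limit_rel I S t =
     {((j, s), (k, u)). j \<in> I \<and> s \<in> S j \<and> k \<in> I \<and> u \<in> S k \<and>
        (\<exists>l\<in>I. j \<le> l \<and> k \<le> l \<and> t j l s = t k l u)}"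

definition direct_limit ::
  "'i::order set \<Rightarrow> ('i \<Rightarrow> 's set) \<Rightarrow> ('i \<Rightarrow> 'i \<Rightarrow> 's \<Rightarrow> 's) \<Rightarrow> ('i \<times> 's) set set" where
  "direct_limit I S t = Sigma I S // direct_limit_rel I S t"

definition cube_classes ::
  "nat \<Rightarrow> 'a set \<Rightarrow> ('a \<times> 'a) set set \<Rightarrow> 'a set \<Rightarrow> 'a \<Rightarrow> nat \<Rightarrow> ((nat \<Rightarrow> int) \<Rightarrow> 'a) set set" where
  "cube_classes n X \<V> A pt m = cube_maps n X \<V> A pt m // cube_homotopy n X \<V> A pt m"

text \<open>The map on homotopy classes induced by \<open>cube_extend\<close>: a class \<open>c\<close> goes to the class of the
  extension of any of its members.\<close>

definition cube_transition ::
  "nat \<Rightarrow> 'a set \<Rightarrow> ('a \<times> 'a) set set \<Rightarrow> 'a set \<Rightarrow> 'a \<Rightarrow> nat \<Rightarrow> nat \<Rightarrow>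
   ((nat \<Rightarrow> int) \<Rightarrow> 'a) set \<Rightarrow> ((nat \<Rightarrow> int) \<Rightarrow> 'a) set" where
  "cube_transition n X \<V> A pt m m' c = cube_homotopy n X \<V> A pt m' `` (cube_extend n m m' ` c)"

type_synonym 'a pi_elem = "(nat \<times> ((nat \<Rightarrow> int) \<Rightarrow> 'a) set) set"

definition pi_set ::
  "nat \<Rightarrow> 'a set \<Rightarrow> ('a \<times> 'a) set set \<Rightarrow> 'a set \<Rightarrow> 'a \<Rightarrow> 'a pi_elem set" where
  "pi_set n X \<V> A pt =
     direct_limit {1..} (cube_classes n X \<V> A pt) (cube_transition n X \<V> A pt)"

definition pi_class ::
  "nat \<Rightarrow> 'a set \<Rightarrow> ('a \<times> 'a) set set \<Rightarrow> 'a set \<Rightarrow> 'a \<Rightarrow> nat \<Rightarrow> ((nat \<Rightarrow> int) \<Rightarrow> 'a) \<Rightarrow> 'a pi_elem" where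
  "pi_class n X \<V> A pt m f =
     direct_limit_rel {1..} (cube_classes n X \<V> A pt) (cube_transition n X \<V> A pt) ``
       {(m, cube_homotopy n X \<V> A pt m `` {f})}"

text \<open>The union is over all representatives of the two arguments. It is a single class exactly when
  the class of \<open>cube_star n m m' f g\<close> does not depend on them.\<close>

definition pi_mult ::
  "nat \<Rightarrow> 'a set \<Rightarrow> ('a \<times> 'a) set set \<Rightarrow> 'a set \<Rightarrow> 'a \<Rightarrow> 'a pi_elem \<Rightarrow> 'a pi_elem \<Rightarrow> 'a pi_elem" where
  "pi_mult n X \<V> A pt P Q =
     \<Union> {pi_class n X \<V> A pt (m + m') (cube_star n m m' f g) | m m' f g.
          1 \<le> m \<and> f \<in> cube_maps n X \<V> A pt m \<and> pi_class n X \<V> A pt m f = P \<and>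
          1 \<le> m' \<and> g \<in> cube_maps n X \<V> A pt m' \<and> pi_class n X \<V> A pt m' g = Q}"

definition rel_pi_sc ::
  "nat \<Rightarrow> 'a set \<Rightarrow> ('a \<times> 'a) set set \<Rightarrow> 'a set \<Rightarrow> 'a \<Rightarrow> 'a pi_elem monoid" where
  "rel_pi_sc n X \<V> A pt =
     \<lparr>carrier = pi_set n X \<V> A pt,
      mult = pi_mult n X \<V> A pt,
      one = pi_class n X \<V> A pt 1 (\<lambda>x\<in>cube n 1. pt)\<rparr>"

definition pi_sc :: "nat \<Rightarrow> 'a set \<Rightarrow> ('a \<times> 'a) set set \<Rightarrow> 'a \<Rightarrow> 'a pi_elem monoid" where
  "pi_sc n X \<V> pt = rel_pi_sc n X \<V> {pt} pt"

end

theory Submission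
  imports Defs
begin

text \<open>Composing a map on \<open>cube n m\<close> with the clamping retraction of the lattice onto the cube makes the
  transition maps inclusions. Since cubes are finite, a homotopy is then just a finite chain of single steps
  \<open>F, G\<close> in which \<open>(F x, G y)\<close> is controlled for all adjacent \<open>x, y\<close>. All
  homotopies of the group axioms are reparametrizations of one coordinate: if \<open>u \<le> v\<close> are
  1-Lipschitz functions on the integers, then \<open>max (u t) (min (v t) k)\<close> is a homotopy from \<open>u\<close>
  to \<open>v\<close>. Shifts give the unit, \<open>\<bar>t - m\<bar>\<close> gives the inverse, and associativity is strict.
  Commutativity is an Eckmann--Hilton argument: shifts in a second direction along which faces are
  collapsed carry a concatenation in the first direction, through its diagonal and antidiagonal
  arrangements, to the one in the opposite order.\<close>

section \<open>Lattice maps\<close>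

definition adj :: "nat \<Rightarrow> (nat \<Rightarrow> int) \<Rightarrow> (nat \<Rightarrow> int) \<Rightarrow> bool" where
  "adj n x y \<longleftrightarrow> (\<forall>i\<in>{1..n}. \<bar>x i - y i\<bar> \<le> 1)"

text \<open>Cutting off below as well, unlike \<open>truncate\<close>, sends every lattice point
  into the cube, so shifted or reflected arguments never leave the domain.\<close>

definition clamp :: "nat \<Rightarrow> nat \<Rightarrow> (nat \<Rightarrow> int) \<Rightarrow> (nat \<Rightarrow> int)" where
  "clamp n m x = (\<lambda>i\<in>{1..n}. max 0 (min (x i) (int m)))"

lemma adj_refl: "adj n x x"
  by (simp add: adj_def)

lemma adj_sym: "adj n x y \<Longrightarrow> adj n y x"
  by (simp add: adj_def abs_minus_commute)

lemma clamp_in_cube: "clamp n m x \<in> cube n m"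
  by (auto simp: clamp_def cube_def)

lemma clamp_cube: "x \<in> cube n m \<Longrightarrow> clamp n m x = x"
  by (rule extensionalityI[of _ "{1..n}"]) (auto simp: clamp_def cube_def PiE_def Pi_def)

lemma clamp_clamp: "m \<le> m' \<Longrightarrow> clamp n m (clamp n m' x) = clamp n m x"
  by (rule ext) (auto simp: clamp_def)

lemma adj_clamp: "adj n x y \<Longrightarrow> adj n (clamp n m x) (clamp n m y)"
  by (force simp: adj_def clamp_def)

lemma finite_cube: "finite (cube n m)"
  by (simp add: cube_def finite_PiE)

section \<open>Controlled pairs, lattice maps and chains of steps\<close>

locale semi_coarse_pair = semi_coarse_space X \<V>
  for X :: "'a set" and \<V> :: "('a \<times> 'a) set set" +
  fixes A :: "'a set" and pt :: 'a and n :: nat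
  assumes A_subset: "A \<subseteq> X" and pt_in_A: "pt \<in> A" and n_pos: "1 \<le> n"
begin

text \<open>A finite set of pairs is controlled iff each of its pairs is. As cubes are finite, the
  structure on \<open>X\<close> enters only through this relation.\<close>

definition R :: "'a \<Rightarrow> 'a \<Rightarrow> bool" where
  "R a b \<longleftrightarrow> {(a, b)} \<in> \<V>"

lemma R_sym: "R a b \<Longrightarrow> R b a"
proof -
  have "{(a, b)}\<inverse> = {(b, a)}" by auto
  then show "R a b \<Longrightarrow> R b a" using inverse_closed[of "{(a, b)}"] by (simp add: R_def)
qed

lemma R_in_X: "R a b \<Longrightarrow> a \<in> X"
  using controlled_subset by (auto simp: R_def)

lemma R_refl: "a \<in> X \<Longrightarrow> R a a"
  using subset_closed[OF diagonal, of "{(a, a)}"] by (auto simp: R_def)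

lemma finite_controlled:
  assumes "finite W" and "\<And>a b. (a, b) \<in> W \<Longrightarrow> R a b"
  shows "W \<in> \<V>"
proof -
  have "(\<lambda>p. {p}) ` W \<subseteq> \<V>" using assms(2) by (auto simp: R_def)
  then show ?thesis using finite_Union_closed[of "(\<lambda>p. {p}) ` W"] assms(1) by simp
qed

text \<open>The face conditions are inequalities rather than equations so that they speak about all
  points beyond a face and survive enlarging \<open>m\<close>. The last two split
  \<open>cube_J\<close> into the faces in directions below \<open>n\<close> and the far face in
  direction \<open>n\<close>.\<close>

definition maps :: "nat \<Rightarrow> ((nat \<Rightarrow> int) \<Rightarrow> 'a) set" where
  "maps m = {F. (\<forall>x. F (clamp n m x) = F x) \<and> (\<forall>x y. adj n x y \<longrightarrow> R (F x) (F y)) \<and>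
     (\<forall>x. \<forall>i\<in>{1..n}. x i \<le> 0 \<or> int m \<le> x i \<longrightarrow> F x \<in> A) \<and>
     (\<forall>x. \<forall>i\<in>{1..<n}. x i \<le> 0 \<or> int m \<le> x i \<longrightarrow> F x = pt) \<and>
     (\<forall>x. int m \<le> x n \<longrightarrow> F x = pt)}"

definition step :: "nat \<Rightarrow> ((nat \<Rightarrow> int) \<Rightarrow> 'a) \<Rightarrow> ((nat \<Rightarrow> int) \<Rightarrow> 'a) \<Rightarrow> bool" where
  "step m F G \<longleftrightarrow> F \<in> maps m \<and> G \<in> maps m \<and> (\<forall>x y. adj n x y \<longrightarrow> R (F x) (G y))"

lemma mapsI:
  assumes "\<And>x. F (clamp n m x) = F x" and "\<And>x y. adj n x y \<Longrightarrow> R (F x) (F y)"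
    and "\<And>x i. i \<in> {1..n} \<Longrightarrow> x i \<le> 0 \<or> int m \<le> x i \<Longrightarrow> F x \<in> A"
    and "\<And>x i. i \<in> {1..<n} \<Longrightarrow> x i \<le> 0 \<or> int m \<le> x i \<Longrightarrow> F x = pt"
    and "\<And>x. int m \<le> x n \<Longrightarrow> F x = pt"
  shows "F \<in> maps m"
  unfolding maps_def using assms by blast

lemma mapsD:
  assumes "F \<in> maps m"
  shows "F (clamp n m x) = F x" and "adj n x y \<Longrightarrow> R (F x) (F y)"
    and "i \<in> {1..n} \<Longrightarrow> x i \<le> 0 \<or> int m \<le> x i \<Longrightarrow> F x \<in> A"
    and "i \<in> {1..<n} \<Longrightarrow> x i \<le> 0 \<or> int m \<le> x i \<Longrightarrow> F x = pt"
    and "int m \<le> x n \<Longrightarrow> F x = pt"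
  using assms unfolding maps_def by blast+

lemma maps_cong:
  assumes "F \<in> maps m" and "clamp n m x = clamp n m y"
  shows "F x = F y"
  using mapsD(1)[OF assms(1)] assms(2) by metis

text \<open>A point beyond a face of the larger cube is also beyond that face of the smaller one,
  and clamping to the larger cube first does not change the clamp to the smaller.\<close>

lemma maps_mono: assumes "m \<le> m'" shows "maps m \<subseteq> maps m'"
proof
  fix F assume F: "F \<in> maps m"
  show "F \<in> maps m'"
  proof (rule mapsI)
    show "F (clamp n m' x) = F x" for x
      by (rule maps_cong[OF F]) (simp add: clamp_clamp assms)
  qed (use F assms in \<open>(fastforce intro: mapsD)+\<close>)
qed

lemma step_mono: "m \<le> m' \<Longrightarrow> step m F G \<Longrightarrow> step m' F G"
  using maps_mono by (auto simp: step_def)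

lemma steps_mono: "m \<le> m' \<Longrightarrow> (step m)\<^sup>*\<^sup>* F G \<Longrightarrow> (step m')\<^sup>*\<^sup>* F G"
  using rtranclp_mono[of "step m" "step m'"] step_mono by blast

lemma step_sym: "step m F G \<Longrightarrow> step m G F"
  unfolding step_def using R_sym adj_sym by blast

lemma steps_sym: "(step m)\<^sup>*\<^sup>* F G \<Longrightarrow> (step m)\<^sup>*\<^sup>* G F"
  by (rule sympD[OF symp_rtranclp]) (auto intro: sympI step_sym)

lemma steps_maps: "(step m)\<^sup>*\<^sup>* F G \<Longrightarrow> F \<in> maps m \<longleftrightarrow> G \<in> maps m"
  by (induction rule: rtranclp_induct) (auto simp: step_def)

lemma steps_chain:
  assumes "\<And>k::int. step m (H k) (H (k + 1))" and "M \<le> N"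
  shows "(step m)\<^sup>*\<^sup>* (H M) (H N)"
  using assms(2)
  by (induction N rule: int_ge_induct) (auto intro: rtranclp.rtrancl_into_rtrancl assms(1))

section \<open>Comparison with bornologous maps of triples and their homotopies\<close>

lemma maps_eqI:
  assumes "F \<in> maps m" "G \<in> maps m" "\<And>x. x \<in> cube n m \<Longrightarrow> F x = G x"
  shows "F = G"
  using assms mapsD(1) clamp_in_cube by (metis ext)

text \<open>Composition with \<open>clamp\<close> is inverse to restriction, and a clamped
  coordinate is 0 or \<open>m\<close> as soon as the original one lies on or beyond a face.\<close>

lemma cube_maps_eq:
  assumes "1 \<le> m"
  shows "cube_maps n X \<V> A pt m = (\<lambda>F. restrict F (cube n m)) ` maps m"
proof (intro equalityI subsetI)
  fix f assume f: "f \<in> cube_maps n X \<V> A pt m"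
  then have ext: "f \<in> cube n m \<rightarrow>\<^sub>E X" and born: "bornologous (cube n m) (cube_sc n m) X \<V> f"
    and fA: "f ` cube_boundary n m \<subseteq> A" and fJ: "f ` cube_J n m \<subseteq> {pt}"
    unfolding cube_maps_def triple_maps_def by auto
  let ?F = "\<lambda>x. f (clamp n m x)"
  have cl: "clamp n m x i = max 0 (min (x i) (int m))" if "i \<in> {1..n}" for x i
    using that by (simp add: clamp_def)
  have "?F \<in> maps m"
  proof (rule mapsI)
    show "?F (clamp n m x) = ?F x" for x by (simp add: clamp_clamp)
    fix x y
    assume "adj n x y"
    then have "adj n (clamp n m x) (clamp n m y)" by (rule adj_clamp)
    then have "{(clamp n m x, clamp n m y)} \<in> cube_sc n m"
      unfolding cube_sc_eq using clamp_in_cube by (auto simp: adj_def)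
    then have "map_prod f f ` {(clamp n m x, clamp n m y)} \<in> \<V>"
      using born unfolding bornologous_def by blast
    then show "R (?F x) (?F y)" by (simp add: R_def)
  next
    fix x i assume i: "i \<in> {1..n}" and xi: "x i \<le> 0 \<or> int m \<le> x i"
    then have "clamp n m x i \<in> {0, int m}" using cl[OF i] by auto
    then show "?F x \<in> A" using i clamp_in_cube fA unfolding cube_boundary_def by blast
  next
    fix x i assume i: "i \<in> {1..<n}" and xi: "x i \<le> 0 \<or> int m \<le> x i"
    then have "clamp n m x i \<in> {0, int m}" using cl[of i] by auto
    moreover have "i \<in> {1..n}" "i \<in> {1..n} - {n}" using i by auto
    ultimately have "clamp n m x \<in> cube_J n m"
      using clamp_in_cube unfolding cube_J_def cube_boundary_def by blast
    then show "?F x = pt" using fJ by blast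
  next
    fix x assume "int m \<le> x n"
    then have "clamp n m x n = int m" using cl[of n] n_pos by auto
    \<comment> \<open>Since \<open>m\<close> is positive, the far face in direction \<open>n\<close>
      avoids \<open>x n = 0\<close>, so the proviso in \<open>cube_J\<close> is vacuous
      here.\<close>
    then have "clamp n m x \<in> cube_J n m" using clamp_in_cube n_pos assms
      unfolding cube_J_def cube_boundary_def by force
    then show "?F x = pt" using fJ by blast
  qed
  moreover have "f = restrict ?F (cube n m)"
    using ext by (intro extensionalityI[of _ "cube n m"]) (auto simp: PiE_def clamp_cube)
  ultimately show "f \<in> (\<lambda>F. restrict F (cube n m)) ` maps m" by blast
next
  fix f assume "f \<in> (\<lambda>F. restrict F (cube n m)) ` maps m"
  then obtain F where F: "F \<in> maps m" and f: "f = restrict F (cube n m)" by blast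
  have inX: "F x \<in> X" for x using R_in_X mapsD(2)[OF F adj_refl] by blast
  have "bornologous (cube n m) (cube_sc n m) X \<V> f"
    unfolding bornologous_def
  proof (intro conjI ballI)
    show "f \<in> cube n m \<rightarrow> X" using inX f by auto
    fix V assume "V \<in> cube_sc n m"
    then have V: "x \<in> cube n m \<and> y \<in> cube n m \<and> adj n x y" if "(x, y) \<in> V" for x y
      using that unfolding cube_sc_eq adj_def by blast
    show "map_prod f f ` V \<in> \<V>"
    proof (rule finite_controlled)
      have "V \<subseteq> cube n m \<times> cube n m" using V by auto
      then show "finite (map_prod f f ` V)"
        by (meson finite_cube finite_SigmaI finite_imageI finite_subset)
    qed (use V f mapsD(2)[OF F] in auto)
  qed
  moreover have "f ` cube_boundary n m \<subseteq> A"
    using mapsD(3)[OF F] f unfolding cube_boundary_def by force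
  moreover have "f ` cube_J n m \<subseteq> {pt}"
  proof clarify
    fix x assume x: "x \<in> cube_J n m"
    then have xc: "x \<in> cube n m" unfolding cube_J_def cube_boundary_def by auto
    \<comment> \<open>If no direction other than \<open>n\<close> has a face coordinate, then
      \<open>x n\<close> is one and is not 0, hence it is \<open>m\<close>.\<close>
    consider "x n = int m" | i where "i \<in> {1..n} - {n}" "x i \<in> {0, int m}"
      using x unfolding cube_J_def cube_boundary_def by blast
    then have "F x = pt"
    proof cases
      case 1 then show ?thesis using mapsD(5)[OF F] by simp
    next
      case (2 i)
      then have "i \<in> {1..<n}" "x i \<le> 0 \<or> int m \<le> x i" by auto
      then show ?thesis using mapsD(4)[OF F] by blast
    qed
    then show "f x = pt" using xc f by simp
  qed
  ultimately show "f \<in> cube_maps n X \<V> A pt m"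
    using inX f unfolding cube_maps_def triple_maps_def by auto
qed

text \<open>The slices of a homotopy at consecutive integer times form a chain of steps. Conversely,
  a finite chain is frozen before its start and after its end; the resulting map has finite image,
  so it is bornologous once it respects single pairs.\<close>

lemma cube_homotopy_iff:
  assumes m: "1 \<le> m" and F: "F \<in> maps m" and G: "G \<in> maps m"
  shows "(restrict F (cube n m), restrict G (cube n m)) \<in> cube_homotopy n X \<V> A pt m
    \<longleftrightarrow> (step m)\<^sup>*\<^sup>* F G"
proof
  assume "(restrict F (cube n m), restrict G (cube n m)) \<in> cube_homotopy n X \<V> A pt m"
  then obtain H M N where
    born: "bornologous (cube n m \<times> UNIV) (sc_prod (cube_sc n m) int_sc) X \<V> H" and "M < N"
    and HM: "\<And>x k. x \<in> cube n m \<Longrightarrow> k \<le> M \<Longrightarrow> H (x, k) = F x"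
    and HN: "\<And>x k. x \<in> cube n m \<Longrightarrow> k \<ge> N \<Longrightarrow> H (x, k) = G x"
    and HA: "H ` (cube_boundary n m \<times> UNIV) \<subseteq> A" and HJ: "H ` (cube_J n m \<times> UNIV) \<subseteq> {pt}"
    unfolding cube_homotopy_def triple_homotopy_def by auto
  have HR: "R (H (x, k)) (H (y, l))"
    if "x \<in> cube n m" "y \<in> cube n m" "adj n x y" "\<bar>k - l\<bar> \<le> 1" for x y k l
  proof -
    have "{(x, y)} \<in> cube_sc n m" using that unfolding cube_sc_eq adj_def by auto
    moreover have "{(k, l)} \<in> int_sc" using that by (simp add: int_sc_def)
    moreover have "{((x, k), (y, l))} \<subseteq> \<Union> {box2 {(x, y)} {(k, l)}}" by (auto simp: box2_def)
    ultimately have "{((x, k), (y, l))} \<in> sc_prod (cube_sc n m) int_sc"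
      unfolding sc_prod_def by (intro CollectI exI[of _ "{box2 {(x, y)} {(k, l)}}"]) auto
    then have "map_prod H H ` {((x, k), (y, l))} \<in> \<V>"
      using born unfolding bornologous_def by blast
    then show ?thesis by (simp add: R_def)
  qed
  define h where "h k = (\<lambda>x. H (x, k))" for k
  have "restrict (h k) (cube n m) \<in> cube_maps n X \<V> A pt m" for k
    unfolding cube_maps_def triple_maps_def
  proof (intro CollectI conjI)
    let ?f = "restrict (h k) (cube n m)"
    show ex: "?f \<in> cube n m \<rightarrow>\<^sub>E X" using HR[OF _ _ adj_refl, THEN R_in_X, of _ k k] by (auto simp: h_def)
    show "bornologous (cube n m) (cube_sc n m) X \<V> ?f"
      unfolding bornologous_def
    proof (intro conjI ballI)
      fix V assume "V \<in> cube_sc n m"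
      then have V: "x \<in> cube n m \<and> y \<in> cube n m \<and> adj n x y" if "(x, y) \<in> V" for x y
        using that unfolding cube_sc_eq adj_def by blast
      show "map_prod ?f ?f ` V \<in> \<V>"
      proof (rule finite_controlled)
        have "V \<subseteq> cube n m \<times> cube n m" using V by auto
        then show "finite (map_prod ?f ?f ` V)"
          by (meson finite_cube finite_SigmaI finite_imageI finite_subset)
      qed (use V HR in \<open>auto simp: h_def\<close>)
    qed (use ex in auto)
    have sub: "cube_boundary n m \<subseteq> cube n m" "cube_J n m \<subseteq> cube n m"
      by (auto simp: cube_boundary_def cube_J_def)
    show "?f ` cube_boundary n m \<subseteq> A" "?f ` cube_J n m \<subseteq> {pt}"
      using HA HJ sub by (auto simp: h_def image_subset_iff subset_iff)
  qed
  \<comment> \<open>Each slice is only known on the cube; \<open>K k\<close> is its extension to the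
    lattice.\<close>
  then have "\<forall>k. \<exists>K. K \<in> maps m \<and> restrict (h k) (cube n m) = restrict K (cube n m)"
    unfolding cube_maps_eq[OF m] by blast
  then obtain K where K: "\<And>k. K k \<in> maps m"
    and hK: "\<And>k. restrict (h k) (cube n m) = restrict (K k) (cube n m)" by metis
  have K_eq: "K k x = H (x, k)" if "x \<in> cube n m" for k x
    using fun_cong[OF hK[of k], of x] that by (simp add: h_def)
  have "step m (K k) (K (k + 1))" for k
    unfolding step_def
  proof (intro conjI allI impI K)
    fix x y assume "adj n x y"
    then have "R (K k (clamp n m x)) (K (k + 1) (clamp n m y))"
      using HR[OF clamp_in_cube clamp_in_cube adj_clamp] by (simp add: K_eq clamp_in_cube)
    then show "R (K k x) (K (k + 1) y)" using mapsD(1)[OF K] by simp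
  qed
  then have "(step m)\<^sup>*\<^sup>* (K M) (K N)" using \<open>M < N\<close> by (intro steps_chain) auto
  moreover have "K M = F" "K N = G"
    by (auto intro!: maps_eqI[OF K] F G simp: K_eq HM HN)
  ultimately show "(step m)\<^sup>*\<^sup>* F G" by simp
next
  assume "(step m)\<^sup>*\<^sup>* F G"
  then obtain N where "(step m ^^ N) F G" by (auto simp: rtranclp_power)
  then obtain K where K: "K 0 = F" "K N = G" "\<And>i. i < N \<Longrightarrow> step m (K i) (K (Suc i))"
    unfolding relpowp_fun_conv by blast
  have Km: "K i \<in> maps m" if "i \<le> N" for i
    using K F that unfolding step_def by (cases i) (auto simp: Suc_le_eq)
  \<comment> \<open>\<open>nat\<close> sends all negative times to the first map of the chain,
    \<open>min\<close> sends all late times to the last.\<close>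
  define H where "H = (\<lambda>(x, k). K (nat (min k (int N))) x)"
  have KR: "R (K i x) (K j y)" if a: "adj n x y" "i \<le> N" "j \<le> N" "\<bar>int i - int j\<bar> \<le> 1" for x y i j
  proof -
    consider "i = j" | "j = Suc i" | "i = Suc j" using a(4) by linarith
    then show ?thesis
    proof cases
      case 1
      then show ?thesis using mapsD(2)[OF Km] a by blast
    next
      case 2
      then show ?thesis using K(3)[of i] a by (simp add: step_def)
    next
      case 3
      then show ?thesis using K(3)[of j] a adj_sym R_sym unfolding step_def by (metis Suc_le_eq)
    qed
  qed
  have HR: "R (H (x, k)) (H (y, l))" if "adj n x y" "\<bar>k - l\<bar> \<le> 1" for x y k l
    unfolding H_def using that by (auto intro!: KR)
  have "H ` (cube n m \<times> UNIV) \<subseteq> (\<Union>i\<le>N. K i ` cube n m)" unfolding H_def by force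
  then have fin: "finite (H ` (cube n m \<times> UNIV))" by (rule finite_subset) (simp add: finite_cube)
  have born: "bornologous (cube n m \<times> UNIV) (sc_prod (cube_sc n m) int_sc) X \<V> H"
    unfolding bornologous_def
  proof (intro conjI ballI)
    have "H (x, k) \<in> X" for x k by (rule R_in_X[OF HR[OF adj_refl, where k = k and l = k]]) simp
    then show "H \<in> cube n m \<times> UNIV \<rightarrow> X" by auto
    fix U assume "U \<in> sc_prod (cube_sc n m) int_sc"
    then obtain B where "B \<subseteq> {box2 V W | V W. V \<in> cube_sc n m \<and> W \<in> int_sc}" "U \<subseteq> \<Union> B"
      unfolding sc_prod_def by blast
    then have U: "x \<in> cube n m \<and> y \<in> cube n m \<and> adj n x y \<and> \<bar>k - l\<bar> \<le> 1"
      if xy: "((x, k), (y, l)) \<in> U" for x y k l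
    proof -
      obtain b where "b \<in> B" and xyb: "((x, k), (y, l)) \<in> b" using xy \<open>U \<subseteq> \<Union> B\<close> by blast
      then obtain V W where VW: "V \<in> cube_sc n m" "W \<in> int_sc" "b = box2 V W"
        using \<open>B \<subseteq> _\<close> by blast
      then have "(x, y) \<in> V" "(k, l) \<in> W" using xyb by (auto simp: box2_def)
      then show ?thesis using VW(1,2) unfolding cube_sc_eq int_sc_def adj_def by blast
    qed
    show "map_prod H H ` U \<in> \<V>"
    proof (rule finite_controlled)
      have "map_prod H H ` U \<subseteq> H ` (cube n m \<times> UNIV) \<times> H ` (cube n m \<times> UNIV)"
        using U by (fastforce simp: image_iff)
      then show "finite (map_prod H H ` U)" using fin finite_subset by blast
      show "R a b" if ab: "(a, b) \<in> map_prod H H ` U" for a b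
      proof -
        obtain x k y l where "((x, k), (y, l)) \<in> U" "a = H (x, k)" "b = H (y, l)"
          using ab by auto
        then show ?thesis using U HR by blast
      qed
    qed
  qed
  have restr: "restrict (K i) (cube n m) \<in> cube_maps n X \<V> A pt m" if "i \<le> N" for i
    using Km[OF that] cube_maps_eq[OF m] by blast
  have sub: "cube_boundary n m \<subseteq> cube n m" "cube_J n m \<subseteq> cube n m"
    by (auto simp: cube_boundary_def cube_J_def)
  have KA: "K i x \<in> A" if "i \<le> N" "x \<in> cube_boundary n m" for i x
    using restr[OF that(1)] that(2) sub unfolding cube_maps_def triple_maps_def
    by (fastforce simp: image_subset_iff)
  have KJ: "K i x = pt" if "i \<le> N" "x \<in> cube_J n m" for i x
    using restr[OF that(1)] that(2) sub unfolding cube_maps_def triple_maps_def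
    by (fastforce simp: image_subset_iff)
  \<comment> \<open>The end time \<open>int N + 1\<close> instead of \<open>int N\<close> keeps the
    two times distinct when the chain is empty.\<close>
  have "\<forall>x\<in>cube n m. \<forall>k\<le>0. H (x, k) = restrict F (cube n m) x"
    "\<forall>x\<in>cube n m. \<forall>k\<ge>int N + 1. H (x, k) = restrict G (cube n m) x"
    unfolding H_def using K by auto
  moreover have "(0::int) < int N + 1" by simp
  moreover have "H ` (cube_boundary n m \<times> UNIV) \<subseteq> A" "H ` (cube_J n m \<times> UNIV) \<subseteq> {pt}"
    unfolding H_def by (auto intro!: KA KJ)
  ultimately show "(restrict F (cube n m), restrict G (cube n m)) \<in> cube_homotopy n X \<V> A pt m"
    using born restr[of 0] restr[of N] K unfolding cube_homotopy_def triple_homotopy_def cube_maps_def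
    by blast
qed

section \<open>The direct limit\<close>

text \<open>This is equality in the direct limit, where transition maps have become inclusions.
  Membership of \<open>F\<close> is demanded because the empty chain relates any function to
  itself.\<close>

definition htp :: "((nat \<Rightarrow> int) \<Rightarrow> 'a) \<Rightarrow> ((nat \<Rightarrow> int) \<Rightarrow> 'a) \<Rightarrow> bool" where
  "htp F G \<longleftrightarrow> (\<exists>l\<ge>1. F \<in> maps l \<and> (step l)\<^sup>*\<^sup>* F G)"

definition cls :: "nat \<Rightarrow> ((nat \<Rightarrow> int) \<Rightarrow> 'a) \<Rightarrow> 'a pi_elem" where
  "cls m F = pi_class n X \<V> A pt m (restrict F (cube n m))"

definition hcls :: "nat \<Rightarrow> ((nat \<Rightarrow> int) \<Rightarrow> 'a) \<Rightarrow> ((nat \<Rightarrow> int) \<Rightarrow> 'a) set" where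
  "hcls m F = cube_homotopy n X \<V> A pt m `` {restrict F (cube n m)}"

lemma htpI: "1 \<le> l \<Longrightarrow> F \<in> maps l \<Longrightarrow> (step l)\<^sup>*\<^sup>* F G \<Longrightarrow> htp F G"
  by (auto simp: htp_def)

lemma htp_refl: "1 \<le> m \<Longrightarrow> F \<in> maps m \<Longrightarrow> htp F F"
  by (auto simp: htp_def)

lemma htp_sym: "htp F G \<Longrightarrow> htp G F"
  unfolding htp_def using steps_sym steps_maps by blast

lemma htp_above:
  assumes "htp F G"
  obtains l where "k \<le> l" "1 \<le> l" "F \<in> maps l" "G \<in> maps l" "(step l)\<^sup>*\<^sup>* F G"
proof -
  obtain l where l: "l \<ge> 1" "F \<in> maps l" "(step l)\<^sup>*\<^sup>* F G" using assms htp_def by auto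
  have "(step (max k l))\<^sup>*\<^sup>* F G" using steps_mono l(3) max.cobounded2 by blast
  moreover have "F \<in> maps (max k l)" using maps_mono[of l "max k l"] l(2) by auto
  ultimately show thesis using that[of "max k l"] steps_maps l(1) by auto
qed

lemma htp_trans [trans]:
  assumes "htp F G" "htp G K"
  shows "htp F K"
proof -
  obtain k where k: "(step k)\<^sup>*\<^sup>* F G" using assms htp_def by auto
  obtain l where l: "k \<le> l" "1 \<le> l" "G \<in> maps l" "(step l)\<^sup>*\<^sup>* G K"
    using htp_above[OF assms(2)] by metis
  have "(step l)\<^sup>*\<^sup>* F G" using k l(1) steps_mono by blast
  then show ?thesis using l steps_maps unfolding htp_def by (meson rtranclp_trans)
qed

lemma hcls_eq:
  assumes "1 \<le> m" "F \<in> maps m"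
  shows "hcls m F = {restrict G (cube n m) | G. G \<in> maps m \<and> (step m)\<^sup>*\<^sup>* F G}"
proof -
  have "g \<in> (\<lambda>F. restrict F (cube n m)) ` maps m"
    if "(restrict F (cube n m), g) \<in> cube_homotopy n X \<V> A pt m" for g
    using that cube_maps_eq[OF assms(1)]
    unfolding cube_homotopy_def triple_homotopy_def cube_maps_def by auto
  then show ?thesis unfolding hcls_def using cube_homotopy_iff[OF assms] by blast
qed

lemma hcls_eq_iff:
  assumes "1 \<le> m" "F \<in> maps m" "G \<in> maps m"
  shows "hcls m F = hcls m G \<longleftrightarrow> (step m)\<^sup>*\<^sup>* F G"
proof
  assume "hcls m F = hcls m G"
  moreover have "restrict G (cube n m) \<in> hcls m G" unfolding hcls_eq[OF assms(1,3)] using assms by blast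
  ultimately have "restrict G (cube n m) \<in> hcls m F" by simp
  then have "(restrict F (cube n m), restrict G (cube n m)) \<in> cube_homotopy n X \<V> A pt m"
    unfolding hcls_def by blast
  then show "(step m)\<^sup>*\<^sup>* F G" using cube_homotopy_iff assms by blast
next
  assume "(step m)\<^sup>*\<^sup>* F G"
  then have "(step m)\<^sup>*\<^sup>* F K \<longleftrightarrow> (step m)\<^sup>*\<^sup>* G K" for K
    by (meson rtranclp_trans steps_sym)
  then show "hcls m F = hcls m G"
    unfolding hcls_eq[OF assms(1,2)] hcls_eq[OF assms(1,3)] by simp
qed

lemma cube_classes_eq: "1 \<le> m \<Longrightarrow> cube_classes n X \<V> A pt m = hcls m ` maps m"
  unfolding cube_classes_def quotient_def hcls_def cube_maps_eq by blast

lemma truncate_eq_clamp: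
  assumes "\<And>i. i \<in> {1..n} \<Longrightarrow> 0 \<le> x i"
  shows "truncate n m x = clamp n m x"
  unfolding truncate_def clamp_def by (rule restrict_ext) (use assms in auto)

lemma cube_nonneg: "x \<in> cube n m \<Longrightarrow> i \<in> {1..n} \<Longrightarrow> 0 \<le> x i"
  unfolding cube_def by (auto dest: PiE_mem)

lemma cube_extend_restrict:
  assumes "F \<in> maps m"
  shows "cube_extend n m m' (restrict F (cube n m)) = restrict F (cube n m')"
  unfolding cube_extend_def compose_def
proof (rule restrict_ext)
  fix x assume "x \<in> cube n m'"
  then have "truncate n m x = clamp n m x" by (rule truncate_eq_clamp[OF cube_nonneg])
  then show "restrict F (cube n m) (truncate n m x) = F x"
    using mapsD(1)[OF assms] by (simp add: clamp_in_cube)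
qed

text \<open>Extending a member of the class yields the restriction of the same lattice map to the
  larger cube, and a chain of steps remains one there. So the image is a union of copies of one
  class.\<close>

lemma cube_transition_hcls:
  assumes "1 \<le> m" "m \<le> m'" and F: "F \<in> maps m"
  shows "cube_transition n X \<V> A pt m m' (hcls m F) = hcls m' F"
proof -
  have m': "1 \<le> m'" using assms by simp
  have "cube_extend n m m' ` hcls m F =
      (\<lambda>G. restrict G (cube n m')) ` {G \<in> maps m. (step m)\<^sup>*\<^sup>* F G}"
    unfolding hcls_eq[OF assms(1) F] setcompr_eq_image image_image
    by (rule image_cong) (auto simp: cube_extend_restrict)
  then have "cube_transition n X \<V> A pt m m' (hcls m F) =
      (\<Union>G\<in>{G \<in> maps m. (step m)\<^sup>*\<^sup>* F G}. hcls m' G)"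
    unfolding cube_transition_def hcls_def by auto
  also have "\<dots> = (\<Union>G\<in>{G \<in> maps m. (step m)\<^sup>*\<^sup>* F G}. hcls m' F)"
  proof (rule SUP_cong[OF refl])
    fix G assume G: "G \<in> {G \<in> maps m. (step m)\<^sup>*\<^sup>* F G}"
    then have "(step m')\<^sup>*\<^sup>* F G" using steps_mono[OF assms(2)] by blast
    then show "hcls m' G = hcls m' F"
      using hcls_eq_iff[OF m'] maps_mono[OF assms(2)] F G by blast
  qed
  \<comment> \<open>The index set contains \<open>F\<close>, so the union of equal sets is not
    empty.\<close>
  also have "\<dots> = hcls m' F" using F by blast
  finally show ?thesis .
qed

text \<open>At a common level \<open>l\<close> both classes are represented by unchanged lattice
  maps, so equality there is a chain of steps in the cube of size \<open>l\<close>;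
  \<open>htp_above\<close> makes \<open>l\<close> exceed both levels.\<close>

lemma direct_limit_rel_iff:
  assumes "1 \<le> m" "1 \<le> m'" and F: "F \<in> maps m" and G: "G \<in> maps m'"
  shows "((m, hcls m F), (m', hcls m' G)) \<in>
      direct_limit_rel {1..} (cube_classes n X \<V> A pt) (cube_transition n X \<V> A pt) \<longleftrightarrow> htp F G"
    (is "?L \<longleftrightarrow> _")
proof -
  have "?L \<longleftrightarrow> (\<exists>l\<ge>1. m \<le> l \<and> m' \<le> l \<and> hcls l F = hcls l G)"
    unfolding direct_limit_rel_def
    using assms cube_transition_hcls by (auto simp: cube_classes_eq)
  also have "\<dots> \<longleftrightarrow> (\<exists>l\<ge>1. m \<le> l \<and> m' \<le> l \<and> (step l)\<^sup>*\<^sup>* F G)"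
    using hcls_eq_iff maps_mono F G by blast
  also have "\<dots> \<longleftrightarrow> htp F G"
  proof
    assume "\<exists>l\<ge>1. m \<le> l \<and> m' \<le> l \<and> (step l)\<^sup>*\<^sup>* F G"
    then show "htp F G" using F maps_mono unfolding htp_def by blast
  next
    assume "htp F G"
    from htp_above[OF this, of "max m m'"]
    show "\<exists>l\<ge>1. m \<le> l \<and> m' \<le> l \<and> (step l)\<^sup>*\<^sup>* F G" by (metis max.bounded_iff)
  qed
  finally show ?thesis .
qed

lemma cls_eq:
  assumes "1 \<le> m" "F \<in> maps m"
  shows "cls m F = {(k, hcls k G) | k G. 1 \<le> k \<and> G \<in> maps k \<and> htp F G}"
proof -
  have "cls m F = direct_limit_rel {1..} (cube_classes n X \<V> A pt) (cube_transition n X \<V> A pt) ``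
      {(m, hcls m F)}" by (simp add: cls_def pi_class_def hcls_def)
  moreover have "\<exists>k G. p = (k, hcls k G) \<and> 1 \<le> k \<and> G \<in> maps k"
    if "((m, hcls m F), p) \<in>
      direct_limit_rel {1..} (cube_classes n X \<V> A pt) (cube_transition n X \<V> A pt)" for p
    using that unfolding direct_limit_rel_def by (auto simp: cube_classes_eq)
  ultimately show ?thesis using direct_limit_rel_iff[OF assms(1) _ assms(2)] by blast
qed

lemma cls_eq_iff:
  assumes "1 \<le> m" "F \<in> maps m" "1 \<le> m'" "G \<in> maps m'"
  shows "cls m F = cls m' G \<longleftrightarrow> htp F G"
proof
  assume "cls m F = cls m' G"
  moreover have "(m', hcls m' G) \<in> cls m' G" using assms htp_refl by (auto simp: cls_eq)
  ultimately have "(m', hcls m' G) \<in> cls m F" by simp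
  then show "htp F G"
    using direct_limit_rel_iff assms by (simp add: cls_def pi_class_def hcls_def)
next
  assume "htp F G"
  then have "htp F K \<longleftrightarrow> htp G K" for K using htp_sym htp_trans by blast
  then show "cls m F = cls m' G"
    unfolding cls_eq[OF assms(1,2)] cls_eq[OF assms(3,4)] by simp
qed

lemma pi_set_eq: "pi_set n X \<V> A pt = {cls m F | m F. 1 \<le> m \<and> F \<in> maps m}"
proof -
  let ?r = "direct_limit_rel {1..} (cube_classes n X \<V> A pt) (cube_transition n X \<V> A pt)"
  have "Sigma {1..} (cube_classes n X \<V> A pt) = (\<lambda>(m, F). (m, hcls m F)) ` Sigma {1..} maps"
    by (auto simp: cube_classes_eq image_iff)
  then have "pi_set n X \<V> A pt = (\<lambda>p. ?r `` {p}) ` (\<lambda>(m, F). (m, hcls m F)) ` Sigma {1..} maps"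
    unfolding pi_set_def direct_limit_def quotient_def by blast
  also have "\<dots> = (\<lambda>(m, F). cls m F) ` Sigma {1..} maps"
    unfolding image_image cls_def pi_class_def hcls_def by (simp add: case_prod_unfold)
  also have "\<dots> = {cls m F | m F. 1 \<le> m \<and> F \<in> maps m}" by auto
  finally show ?thesis .
qed

section \<open>Concatenation\<close>

text \<open>These are the directions whose two opposite faces go to the base point; the face \<open>x n = 0\<close> only
  goes to \<open>A\<close>.\<close>

definition dir :: "nat \<Rightarrow> bool" where
  "dir d \<longleftrightarrow> d \<in> {1..n} \<and> (d \<noteq> n \<or> A = {pt})"

definition shift :: "nat \<Rightarrow> nat \<Rightarrow> ((nat \<Rightarrow> int) \<Rightarrow> 'a) \<Rightarrow> ((nat \<Rightarrow> int) \<Rightarrow> 'a)" where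
  "shift d m F = (\<lambda>x. F (x(d := x d - int m)))"

text \<open>The direction is a parameter because commutativity needs a second one. No truncation
  appears, since lattice maps are already constant along clamping.\<close>

definition star :: "nat \<Rightarrow> nat \<Rightarrow> ((nat \<Rightarrow> int) \<Rightarrow> 'a) \<Rightarrow> ((nat \<Rightarrow> int) \<Rightarrow> 'a) \<Rightarrow> ((nat \<Rightarrow> int) \<Rightarrow> 'a)" where
  "star d m F G = (\<lambda>x. if x d \<le> int m then F x else shift d m G x)"

text \<open>In direction \<open>n\<close> the near face is only sent to \<open>A\<close>, which is
  why \<open>dir\<close> asks for \<open>A = {pt}\<close> there.\<close>

lemma maps_dir:
  assumes "F \<in> maps m" "dir d" "x d \<le> 0 \<or> int m \<le> x d"
  shows "F x = pt"
proof (cases "d = n")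
  case True
  then show ?thesis using assms mapsD(3)[OF assms(1), of n] unfolding dir_def by auto
next
  case False
  then show ?thesis using assms mapsD(4)[OF assms(1), of d] unfolding dir_def by auto
qed

lemma adj_shift: "adj n x y \<Longrightarrow> adj n (x(d := x d - c)) (y(d := y d - c))"
  by (auto simp: adj_def)

text \<open>Adjacent points on different sides of the cut include one on the cut itself. There the
  left factor is \<open>pt\<close>, which is also the value of the right factor on its near face, so
  the comparison can be made within the right factors.\<close>

lemma star_R:
  assumes d: "dir d" and F: "\<And>x. int m \<le> x d \<Longrightarrow> F x = pt" "\<And>x. int m \<le> x d \<Longrightarrow> F' x = pt"
    and G: "G \<in> maps m'" "G' \<in> maps m'"
    and FF: "\<And>x y. adj n x y \<Longrightarrow> R (F x) (F' y)" and GG: "\<And>x y. adj n x y \<Longrightarrow> R (G x) (G' y)"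
    and adj: "adj n x y"
  shows "R (star d m F G x) (star d m F' G' y)"
proof -
  let ?s = "\<lambda>x. x(d := x d - int m)"
  have s: "adj n (?s x) (?s y)" by (rule adj_shift[OF adj])
  have xy: "\<bar>x d - y d\<bar> \<le> 1" using adj d unfolding adj_def dir_def by blast
  consider "x d \<le> int m" "y d \<le> int m" | "x d > int m" "y d > int m"
    | "x d = int m" "y d > int m" | "y d = int m" "x d > int m"
    using xy by linarith
  then show ?thesis
  proof cases
    case 3
    have "F x = pt" using F(1)[of x] 3 by simp
    moreover have "G (?s x) = pt" using maps_dir[OF G(1) d, of "?s x"] 3 by simp
    ultimately show ?thesis using GG[OF s] 3 by (simp add: star_def shift_def)
  next
    case 4
    have "F' y = pt" using F(2)[of y] 4 by simp
    moreover have "G' (?s y) = pt" using maps_dir[OF G(2) d, of "?s y"] 4 by simp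
    ultimately show ?thesis using GG[OF s] 4 by (simp add: star_def shift_def)
  qed (use FF[OF adj] GG[OF s] in \<open>simp_all add: star_def shift_def\<close>)
qed

text \<open>\<open>F\<close> may live on a cube larger than the cut \<open>m\<close>: this happens to shifts in the other
  direction in the commutativity proof.\<close>

lemma star_maps_thin:
  assumes d: "dir d" and F: "F \<in> maps k" and mk: "m \<le> k" and thin: "\<And>x. int m \<le> x d \<Longrightarrow> F x = pt"
    and G: "G \<in> maps m'" and m': "1 \<le> m'"
  shows "star d m F G \<in> maps (k + m')"
proof (rule mapsI)
  let ?S = "star d m F G" and ?s = "\<lambda>x. x(d := x d - int m)"
  have dn: "d \<in> {1..n}" using d by (simp add: dir_def)
  show "?S (clamp n (k + m') x) = ?S x" for x
  proof -
    let ?c = "clamp n (k + m') x"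
    have c: "?c i = max 0 (min (x i) (int k + int m'))" if "i \<in> {1..n}" for i
      using that by (simp add: clamp_def)
    \<comment> \<open>As \<open>m'\<close> is positive, clamping does not push points beyond the cut
      back onto it.\<close>
    have le: "?c d \<le> int m \<longleftrightarrow> x d \<le> int m" using m' mk unfolding c[OF dn] by auto
    have "F ?c = F x" by (rule maps_cong[OF F]) (simp add: clamp_clamp)
    moreover have "G (?s ?c) = G (?s x)" if "x d > int m"
    proof (rule maps_cong[OF G], rule ext)
      fix i show "clamp n m' (?s ?c) i = clamp n m' (?s x) i"
        using that c mk by (auto simp: clamp_def)
    qed
    ultimately show ?thesis using le by (auto simp: star_def shift_def)
  qed
  show "R (?S x) (?S y)" if "adj n x y" for x y
    by (rule star_R[OF d thin thin G G]) (use mapsD(2) F G that in auto)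
  show "?S x \<in> A" if i: "i \<in> {1..n}" and x: "x i \<le> 0 \<or> int (k + m') \<le> x i" for x i
  proof (cases "x d \<le> int m")
    case True
    then show ?thesis using mapsD(3)[OF F i, of x] x by (auto simp: star_def)
  next
    case False
    then have "?s x i \<le> 0 \<or> int m' \<le> ?s x i" using x mk by auto
    then show ?thesis using mapsD(3)[OF G i, of "?s x"] False by (simp add: star_def shift_def)
  qed
  show "?S x = pt" if i: "i \<in> {1..<n}" and x: "x i \<le> 0 \<or> int (k + m') \<le> x i" for x i
  proof (cases "x d \<le> int m")
    case True
    then show ?thesis using mapsD(4)[OF F i, of x] x by (auto simp: star_def)
  next
    case False
    then have "?s x i \<le> 0 \<or> int m' \<le> ?s x i" using x mk by auto
    then show ?thesis using mapsD(4)[OF G i, of "?s x"] False by (simp add: star_def shift_def)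
  qed
  show "?S x = pt" if "int (k + m') \<le> x n" for x
  proof (cases "x d \<le> int m")
    case True
    then show ?thesis using mapsD(5)[OF F, of x] that by (simp add: star_def)
  next
    case False
    then have "int m' \<le> ?s x n" using that mk by auto
    then show ?thesis using mapsD(5)[OF G, of "?s x"] False by (simp add: star_def shift_def)
  qed
qed

lemma star_maps:
  assumes "dir d" "F \<in> maps m" "G \<in> maps m'" "1 \<le> m'"
  shows "star d m F G \<in> maps (m + m')"
  using star_maps_thin[OF assms(1,2) order.refl _ assms(3,4)] maps_dir[OF assms(2,1)] by blast

lemma star_steps:
  assumes d: "dir d" and F: "F \<in> maps m" and G: "G \<in> maps m'" and m': "1 \<le> m'"
    and FF: "(step m)\<^sup>*\<^sup>* F F'" and GG: "(step m')\<^sup>*\<^sup>* G G'"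
  shows "(step (m + m'))\<^sup>*\<^sup>* (star d m F G) (star d m F' G')"
proof -
  have st: "step (m + m') (star d m K L) (star d m K' L')"
    if "step m K K'" "step m' L L'" for K K' L L'
    unfolding step_def
  proof (intro conjI allI impI)
    have K: "K \<in> maps m" "K' \<in> maps m" and L: "L \<in> maps m'" "L' \<in> maps m'"
      using that by (auto simp: step_def)
    show "star d m K L \<in> maps (m + m')" "star d m K' L' \<in> maps (m + m')"
      using star_maps[OF d _ _ m'] K L by auto
    show "R (star d m K L x) (star d m K' L' y)" if "adj n x y" for x y
      by (rule star_R[OF d _ _ L]) (use maps_dir[OF K(1) d] maps_dir[OF K(2) d] that
          \<open>step m K K'\<close> \<open>step m' L L'\<close> in \<open>auto simp: step_def\<close>)
  qed
  have refl: "step k K K" if "K \<in> maps k" for k K using that mapsD(2) by (auto simp: step_def)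
  \<comment> \<open>The factors are moved one after the other, as the two chains may differ in
    length.\<close>
  have "(step (m + m'))\<^sup>*\<^sup>* (star d m F G) (star d m F' G)" using FF
    by (induction rule: rtranclp_induct) (auto intro: rtranclp.rtrancl_into_rtrancl st refl G)
  moreover have "F' \<in> maps m" using FF F steps_maps by blast
  from GG have "(step (m + m'))\<^sup>*\<^sup>* (star d m F' G) (star d m F' G')"
    by (induction rule: rtranclp_induct)
       (auto intro: rtranclp.rtrancl_into_rtrancl st refl \<open>F' \<in> maps m\<close>)
  ultimately show ?thesis by (rule rtranclp_trans)
qed

section \<open>Reparametrization of one coordinate\<close>

text \<open>Minima and maxima of 1-Lipschitz functions are 1-Lipschitz, which makes
  \<open>max (u t) (min (v t) k)\<close> jointly 1-Lipschitz in \<open>t\<close> and \<open>k\<close>.\<close>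

definition lip :: "(int \<Rightarrow> int) \<Rightarrow> bool" where
  "lip u \<longleftrightarrow> (\<forall>s t. \<bar>s - t\<bar> \<le> 1 \<longrightarrow> \<bar>u s - u t\<bar> \<le> 1)"

definition reparam :: "nat \<Rightarrow> (int \<Rightarrow> int) \<Rightarrow> ((nat \<Rightarrow> int) \<Rightarrow> 'a) \<Rightarrow> ((nat \<Rightarrow> int) \<Rightarrow> 'a)" where
  "reparam d u F = (\<lambda>x. F (x(d := u (x d))))"

text \<open>\<open>u\<close> need not commute with clamping. Where coordinate \<open>d\<close> is on
  or beyond a face, both sides are \<open>pt\<close>; elsewhere clamping leaves that coordinate
  alone.\<close>

lemma reparam_maps:
  assumes d: "dir d" and F: "F \<in> maps m" and "m \<le> m'" and "lip u"
    and u: "\<And>t. t \<le> 0 \<or> int m' \<le> t \<Longrightarrow> u t \<le> 0 \<or> int m \<le> u t"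
  shows "reparam d u F \<in> maps m'"
proof (rule mapsI)
  let ?s = "\<lambda>x. x(d := u (x d))"
  have dn: "d \<in> {1..n}" using d by (simp add: dir_def)
  have out: "reparam d u F x = pt" if "x d \<le> 0 \<or> int m' \<le> x d" for x
    using maps_dir[OF F d, of "?s x"] u[OF that] by (simp add: reparam_def)
  show "reparam d u F (clamp n m' x) = reparam d u F x" for x
  proof (cases "x d \<le> 0 \<or> int m' \<le> x d")
    case True
    then have "clamp n m' x d \<le> 0 \<or> int m' \<le> clamp n m' x d" using dn by (auto simp: clamp_def)
    then show ?thesis using out True by metis
  next
    case False
    then have "clamp n m' x d = x d" using dn by (simp add: clamp_def)
    then have "clamp n m (?s (clamp n m' x)) = clamp n m (?s x)"
      using \<open>m \<le> m'\<close> by (intro ext) (auto simp: clamp_def)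
    then show ?thesis unfolding reparam_def by (rule maps_cong[OF F])
  qed
  show "R (reparam d u F x) (reparam d u F y)" if "adj n x y" for x y
    unfolding reparam_def
    by (rule mapsD(2)[OF F]) (use that \<open>lip u\<close> in \<open>auto simp: adj_def lip_def\<close>)
  show "reparam d u F x \<in> A" if "i \<in> {1..n}" "x i \<le> 0 \<or> int m' \<le> x i" for x i
  proof (cases "i = d")
    case True then show ?thesis using out[of x] that pt_in_A by simp
  next
    case False then show ?thesis
      using mapsD(3)[OF F that(1), of "?s x"] that \<open>m \<le> m'\<close> by (auto simp: reparam_def)
  qed
  show "reparam d u F x = pt" if "i \<in> {1..<n}" "x i \<le> 0 \<or> int m' \<le> x i" for x i
  proof (cases "i = d")
    case True then show ?thesis using out[of x] that by simp
  next
    case False then show ?thesis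
      using mapsD(4)[OF F that(1), of "?s x"] that \<open>m \<le> m'\<close> by (auto simp: reparam_def)
  qed
  show "reparam d u F x = pt" if "int m' \<le> x n" for x
  proof (cases "n = d")
    case True then show ?thesis using out[of x] that by simp
  next
    case False then show ?thesis
      using mapsD(5)[OF F, of "?s x"] that \<open>m \<le> m'\<close> by (auto simp: reparam_def)
  qed
qed

text \<open>All interpolating functions lie between \<open>u\<close> and \<open>v\<close>. Hence
  \<open>out\<close> keeps the whole family at or below 0, or at or above \<open>m\<close>, outside
  the slab, and every stage is a lattice map.\<close>

lemma reparam_steps:
  assumes d: "dir d" and F: "F \<in> maps m" and mm: "m \<le> m'" and u: "lip u" and v: "lip v"
    and uv: "\<And>t. u t \<le> v t" and out: "\<And>t. t \<le> 0 \<or> int m' \<le> t \<Longrightarrow> v t \<le> 0 \<or> int m \<le> u t"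
  shows "(step m')\<^sup>*\<^sup>* (reparam d u F) (reparam d v F)"
proof -
  define h where "h k = (\<lambda>t. max (u t) (min (v t) k))" for k
  have lip: "\<bar>h k s - h l t\<bar> \<le> 1" if "\<bar>s - t\<bar> \<le> 1" "\<bar>k - l\<bar> \<le> 1" for k l s t
  proof -
    have "\<bar>u s - u t\<bar> \<le> 1" "\<bar>v s - v t\<bar> \<le> 1" using that u v by (auto simp: lip_def)
    then show ?thesis using that(2) unfolding h_def by linarith
  qed
  have "reparam d (h k) F \<in> maps m'" for k
  proof (rule reparam_maps[OF d F mm])
    show "lip (h k)" using lip unfolding lip_def by simp
    show "h k t \<le> 0 \<or> int m \<le> h k t" if "t \<le> 0 \<or> int m' \<le> t" for t
      using out[OF that] uv[of t] unfolding h_def by linarith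
  qed
  moreover have "R (reparam d (h k) F x) (reparam d (h (k + 1)) F y)" if "adj n x y" for k x y
    unfolding reparam_def
    by (rule mapsD(2)[OF F]) (use that lip in \<open>auto simp: adj_def\<close>)
  ultimately have "step m' (reparam d (h k) F) (reparam d (h (k + 1)) F)" for k
    unfolding step_def by blast
  \<comment> \<open>Times 0 and \<open>m\<close> suffice: \<open>h 0\<close> differs from
    \<open>u\<close> only where both are at most 0, and \<open>h (int m)\<close> from
    \<open>v\<close> only where both are at least \<open>m\<close>, and there \<open>F\<close> is
    \<open>pt\<close>.\<close>
  then have "(step m')\<^sup>*\<^sup>* (reparam d (h 0) F) (reparam d (h (int m)) F)"
    by (intro steps_chain) auto
  moreover have "reparam d (h 0) F x = reparam d u F x" for x
  proof (cases "u (x d) \<le> 0")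
    case True
    then have "h 0 (x d) \<le> 0" unfolding h_def by linarith
    then show ?thesis using True maps_dir[OF F d] by (simp add: reparam_def)
  next
    case False
    then have "h 0 (x d) = u (x d)" unfolding h_def by linarith
    then show ?thesis by (simp add: reparam_def)
  qed
  moreover have "reparam d (h (int m)) F x = reparam d v F x" for x
  proof (cases "v (x d) \<le> int m")
    case True
    then have "h (int m) (x d) = v (x d)" using uv[of "x d"] unfolding h_def by linarith
    then show ?thesis by (simp add: reparam_def)
  next
    case False
    then have "h (int m) (x d) \<ge> int m" unfolding h_def by linarith
    then show ?thesis using False maps_dir[OF F d] by (simp add: reparam_def)
  qed
  ultimately show ?thesis by (metis ext)
qed

lemma shift_steps:
  assumes d: "dir d" and F: "F \<in> maps m"
  shows "(step (m + k))\<^sup>*\<^sup>* (shift d k F) F"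
proof -
  have "(step (m + k))\<^sup>*\<^sup>* (reparam d (\<lambda>t. t - int k) F) (reparam d (\<lambda>t. t) F)"
    by (rule reparam_steps[OF d F]) (auto simp: lip_def)
  then show ?thesis by (simp add: reparam_def shift_def)
qed

lemma shift_maps:
  assumes "dir d" "F \<in> maps m"
  shows "shift d k F \<in> maps (m + k)"
  using steps_maps[OF shift_steps[OF assms]] maps_mono[of m "m + k"] assms by auto

lemma const_maps: "(\<lambda>_. pt) \<in> maps m"
  using R_refl A_subset pt_in_A by (auto intro!: mapsI)

lemma star_const: "dir d \<Longrightarrow> F \<in> maps k \<Longrightarrow> star d m (\<lambda>_. pt) F = shift d m F"
  using maps_dir[of F k d] by (auto simp: star_def shift_def fun_eq_iff)


section \<open>Group axioms\<close>

text \<open>Both sides are cut at \<open>m\<close> and \<open>m + m'\<close>, and the nested shifts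
  add up.\<close>

lemma star_assoc: "star d (m + m') (star d m F G) K = star d m F (star d m' G K)"
  by (auto simp: star_def shift_def fun_eq_iff algebra_simps)

text \<open>Moving the cut from \<open>m\<close> to \<open>l\<close> inserts a slab with value
  \<open>pt\<close>. The function \<open>u\<close>, constant on that slab, collapses it and is
  homotopic to the identity.\<close>

lemma star_pad:
  assumes d: "dir d" and F: "F \<in> maps k" and mk: "m \<le> k" and thin: "\<And>x. int m \<le> x d \<Longrightarrow> F x = pt"
    and G: "G \<in> maps m'" and m': "1 \<le> m'" and ml: "m \<le> l"
  shows "htp (star d m F G) (star d l F G)"
proof -
  define u where "u t = max (min t (int m)) (t - (int l - int m))" for t
  have S: "star d m F G \<in> maps (k + m')" by (rule star_maps_thin[OF d F mk thin G m'])
  have "star d l F G x = reparam d u (star d m F G) x" for x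
  proof -
    consider "x d \<le> int m" | "int m < x d" "x d \<le> int l" | "int l < x d" by linarith
    then show ?thesis
    proof cases
      case 1
      then have "u (x d) = x d" using ml by (simp add: u_def)
      then show ?thesis using 1 ml by (simp add: star_def reparam_def)
    next
      case 2
      then have "u (x d) = int m" by (simp add: u_def)
      then show ?thesis using 2 thin by (simp add: star_def reparam_def)
    next
      case 3
      then have "u (x d) = x d - (int l - int m)" using ml by (simp add: u_def)
      then show ?thesis using 3 ml by (simp add: star_def shift_def reparam_def)
    qed
  qed
  then have eq: "star d l F G = reparam d u (star d m F G)" by blast
  \<comment> \<open>The added \<open>l\<close> absorbs the delay of \<open>u\<close>: on and beyond
    the far face \<open>u t\<close> is still at least \<open>k + m'\<close>.\<close>
  have "(step (k + m' + l))\<^sup>*\<^sup>* (reparam d u (star d m F G)) (reparam d (\<lambda>t. t) (star d m F G))"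
  proof (rule reparam_steps[OF d S])
    show "lip u" unfolding lip_def u_def by auto
  qed (use ml in \<open>auto simp: lip_def u_def\<close>)
  then have "(step (k + m' + l))\<^sup>*\<^sup>* (star d m F G) (star d l F G)"
    using steps_sym unfolding eq by (simp add: reparam_def)
  then show ?thesis
    using S maps_mono[of "k + m'" "k + m' + l"] m' by (intro htpI[of "k + m' + l"]) auto
qed

text \<open>The chain from \<open>F\<close> to \<open>F'\<close> lives on some cube of size
  \<open>l\<close>, while the cuts are at \<open>m\<close> and \<open>k\<close>. So the cut is moved
  out to \<open>l\<close>, the factors are deformed, and the cut is moved back.\<close>

lemma star_htp:
  assumes d: "dir d" and F: "F \<in> maps m" and F': "F' \<in> maps k" and G: "G \<in> maps m'"
    and G': "G' \<in> maps k'" and m': "1 \<le> m'" and k': "1 \<le> k'" and "htp F F'" "htp G G'"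
  shows "htp (star d m F G) (star d k F' G')"
proof -
  obtain l where l: "max m k \<le> l" "1 \<le> l" "F \<in> maps l" "(step l)\<^sup>*\<^sup>* F F'"
    using htp_above[OF \<open>htp F F'\<close>] by metis
  obtain l' where l': "1 \<le> l'" "G \<in> maps l'" "(step l')\<^sup>*\<^sup>* G G'"
    using htp_above[OF \<open>htp G G'\<close>] by metis
  have "htp (star d m F G) (star d l F G)"
    by (rule star_pad[OF d F order.refl _ G m']) (use l maps_dir[OF F d] in auto)
  also have "htp (star d l F G) (star d l F' G')"
    using star_steps[OF d l(3) l'(2,1) l(4) l'(3)] star_maps[OF d l(3) l'(2,1)] l'(1)
    by (intro htpI[of "l + l'"]) auto
  also have "htp (star d l F' G') (star d k F' G')"
    by (rule htp_sym[OF star_pad[OF d F' order.refl _ G' k']]) (use l maps_dir[OF F' d] in auto)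
  finally show ?thesis .
qed

text \<open>With \<open>d\<close> horizontal and \<open>e\<close> vertical: raise \<open>G\<close>,
  so \<open>F\<close> is lower left and \<open>G\<close> upper right; read this as a vertical
  concatenation; move \<open>F\<close> right and \<open>G\<close> left; read the result
  horizontally, with \<open>G\<close> first; lower \<open>G\<close>.\<close>

lemma star_comm:
  assumes d: "dir d" and e: "dir e" and "d \<noteq> e" and m: "1 \<le> m"
    and F: "F \<in> maps m" and G: "G \<in> maps m"
  shows "htp (star d m F G) (star d m G F)"
proof -
  have sh: "htp K (shift c m K)" "htp (shift c m K) K" if "dir c" "K \<in> maps m" for c K
    using htpI[OF _ shift_maps[OF that] shift_steps[OF that]] m htp_sym by auto
  have sh_maps: "shift c m K \<in> maps (m + m)" if "dir c" "K \<in> maps m" for c K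
    using shift_maps that by blast
  have sh_eq: "shift d m K (x(e := s)) = K (x(d := x d - int m, e := s))"
    "shift e m K (x(d := s)) = K (x(d := s, e := x e - int m))" for K x s
    using \<open>d \<noteq> e\<close> by (simp_all add: shift_def fun_upd_twist)
  have m2: "1 \<le> m + m" using m by simp
  \<comment> \<open>In each of the two remaining quadrants one side evaluates \<open>F\<close> and
    the other \<open>G\<close>, both beyond a face, so both are \<open>pt\<close>.\<close>
  have diag: "star d m F (shift e m G) x = star e m F (shift d m G) x" for x
    using maps_dir[OF F d, of x] maps_dir[OF F e, of x] \<open>d \<noteq> e\<close>
      maps_dir[OF G d, of "x(d := x d - int m, e := x e - int m)"]
      maps_dir[OF G e, of "x(d := x d - int m, e := x e - int m)"]
    by (auto simp: star_def shift_def[of d m "shift e m G"] shift_def[of e m "shift d m G"] sh_eq)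
  have antidiag: "star e m (shift d m F) G x = star d m (shift e m G) F x" for x
    using maps_dir[OF F d, of "x(d := x d - int m)"] maps_dir[OF F e, of "x(d := x d - int m)"]
      maps_dir[OF G d, of "x(e := x e - int m)"] maps_dir[OF G e, of "x(e := x e - int m)"]
      \<open>d \<noteq> e\<close>
    by (auto simp: star_def shift_def)
  have "htp (star d m F G) (star d m F (shift e m G))"
    by (rule star_htp[OF d F F G sh_maps[OF e G] m m2 htp_refl[OF m F] sh(1)[OF e G]])
  also have "star d m F (shift e m G) = star e m F (shift d m G)" using diag by (rule ext)
  also have "htp (star e m F (shift d m G)) (star e (m + m) (shift d m F) G)"
    by (rule star_htp[OF e F sh_maps[OF d F] sh_maps[OF d G] G m2 m sh(1)[OF d F] sh(2)[OF d G]])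
  \<comment> \<open>A shifted map occupies a cube of size \<open>m + m\<close>, so the cut ended up
    there; the shift is along \<open>d\<close>, so in direction \<open>e\<close> the map is still
    \<open>pt\<close> from \<open>m\<close> on.\<close>
  also have "htp (star e (m + m) (shift d m F) G) (star e m (shift d m F) G)"
    by (rule htp_sym[OF star_pad[OF e sh_maps[OF d F] _ _ G m]])
       (use maps_dir[OF F e] \<open>d \<noteq> e\<close> in \<open>auto simp: shift_def\<close>)
  also have "star e m (shift d m F) G = star d m (shift e m G) F" using antidiag by (rule ext)
  also have "htp (star d m (shift e m G) F) (star d (m + m) (shift e m G) F)"
    by (rule star_pad[OF d sh_maps[OF e G] _ _ F m])
       (use maps_dir[OF G d] \<open>d \<noteq> e\<close> in \<open>auto simp: shift_def\<close>)
  also have "htp (star d (m + m) (shift e m G) F) (star d m G F)"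
    by (rule star_htp[OF d sh_maps[OF e G] G F F m m sh(2)[OF e G] htp_refl[OF m F]])
  finally show ?thesis .
qed

section \<open>Products of classes and the axioms\<close>

lemma cube_star_restrict:
  assumes F: "F \<in> maps m" and G: "G \<in> maps m'"
  shows "cube_star n m m' (restrict F (cube n m)) (restrict G (cube n m')) =
    restrict (star 1 m F G) (cube n (m + m'))"
  unfolding cube_star_def
proof (rule restrict_ext)
  fix x assume x: "x \<in> cube n (m + m')"
  let ?s = "x(1 := x 1 - int m)"
  have "truncate n m x = clamp n m x" by (rule truncate_eq_clamp[OF cube_nonneg[OF x]])
  \<comment> \<open>Beyond the cut the shifted coordinate is positive, so the lower cut-off of
    \<open>clamp\<close> has no effect.\<close>
  moreover have "truncate n m' ?s = clamp n m' ?s" if "\<not> x 1 \<le> int m"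
    by (rule truncate_eq_clamp) (use that cube_nonneg[OF x] in auto)
  ultimately show "(if x 1 \<le> int m then restrict F (cube n m) (truncate n m x)
      else restrict G (cube n m') (truncate n m' ?s)) = star 1 m F G x"
    using mapsD(1)[OF F] mapsD(1)[OF G] by (simp add: star_def shift_def clamp_in_cube)
qed

text \<open>By \<open>star_htp\<close> every choice of representatives contributes the same class to
  the union defining \<open>pi_mult\<close>, and the restrictions of \<open>F\<close> and
  \<open>G\<close> are one choice.\<close>

lemma pi_mult_cls:
  assumes d: "dir 1" and m: "1 \<le> m" "1 \<le> m'" and F: "F \<in> maps m" and G: "G \<in> maps m'"
  shows "pi_mult n X \<V> A pt (cls m F) (cls m' G) = cls (m + m') (star 1 m F G)"
proof -
  have rep: "pi_class n X \<V> A pt (a + b) (cube_star n a b f g) = cls (m + m') (star 1 m F G)"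
    if f: "1 \<le> a" "f \<in> cube_maps n X \<V> A pt a" "pi_class n X \<V> A pt a f = cls m F"
      and g: "1 \<le> b" "g \<in> cube_maps n X \<V> A pt b" "pi_class n X \<V> A pt b g = cls m' G" for a b f g
  proof -
    obtain F' where F': "F' \<in> maps a" "f = restrict F' (cube n a)"
      using f(2) unfolding cube_maps_eq[OF f(1)] by blast
    obtain G' where G': "G' \<in> maps b" "g = restrict G' (cube n b)"
      using g(2) unfolding cube_maps_eq[OF g(1)] by blast
    have "htp F' F" using f(3) cls_eq_iff[OF f(1) F'(1) m(1) F] F'(2) by (simp add: cls_def)
    moreover have "htp G' G" using g(3) cls_eq_iff[OF g(1) G'(1) m(2) G] G'(2) by (simp add: cls_def)
    ultimately have "htp (star 1 a F' G') (star 1 m F G)"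
      by (rule star_htp[OF d F'(1) F G'(1) G g(1) m(2)])
    then have "cls (a + b) (star 1 a F' G') = cls (m + m') (star 1 m F G)"
      using cls_eq_iff star_maps[OF d F'(1) G'(1) g(1)] star_maps[OF d F G m(2)] f(1) m(1) by simp
    then show ?thesis using cube_star_restrict[OF F'(1) G'(1)] F'(2) G'(2) by (simp add: cls_def)
  qed
  let ?f = "restrict F (cube n m)" and ?g = "restrict G (cube n m')"
  have "?f \<in> cube_maps n X \<V> A pt m" "?g \<in> cube_maps n X \<V> A pt m'"
    using F G cube_maps_eq m by blast+
  moreover have "pi_class n X \<V> A pt m ?f = cls m F" "pi_class n X \<V> A pt m' ?g = cls m' G"
    by (simp_all add: cls_def)
  ultimately have "{pi_class n X \<V> A pt (a + b) (cube_star n a b f g) | a b f g.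
      1 \<le> a \<and> f \<in> cube_maps n X \<V> A pt a \<and> pi_class n X \<V> A pt a f = cls m F \<and>
      1 \<le> b \<and> g \<in> cube_maps n X \<V> A pt b \<and> pi_class n X \<V> A pt b g = cls m' G} =
      {cls (m + m') (star 1 m F G)}"
    using rep m by blast
  then show ?thesis unfolding pi_mult_def by simp
qed

lemma group_rel_pi_sc:
  assumes d: "dir 1"
  shows "group (rel_pi_sc n X \<V> A pt)"
proof -
  let ?one = "cls 1 (\<lambda>_. pt)"
  have closed: "cls (m + m') (star 1 m F G) \<in> pi_set n X \<V> A pt"
    if "1 \<le> m" "1 \<le> m'" "F \<in> maps m" "G \<in> maps m'" for m m' F G
    unfolding pi_set_eq using star_maps[OF d that(3,4,2)] that(1) by (blast intro: trans_le_add1)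
  have one: "one (rel_pi_sc n X \<V> A pt) = ?one" by (simp add: rel_pi_sc_def cls_def)
  show ?thesis
  proof (rule groupI, unfold one, unfold rel_pi_sc_def, simp_all only: monoid.simps partial_object.simps)
    fix P Q assume "P \<in> pi_set n X \<V> A pt" "Q \<in> pi_set n X \<V> A pt"
    then show "pi_mult n X \<V> A pt P Q \<in> pi_set n X \<V> A pt"
      unfolding pi_set_eq[unfolded atomize_eq] using pi_mult_cls[OF d] closed pi_set_eq by auto
  next
    show "?one \<in> pi_set n X \<V> A pt" unfolding pi_set_eq using const_maps by blast
  next
    fix P Q S assume "P \<in> pi_set n X \<V> A pt" "Q \<in> pi_set n X \<V> A pt" "S \<in> pi_set n X \<V> A pt"
    then obtain m F m' G k K where
      P: "P = cls m F" "1 \<le> m" "F \<in> maps m" and Q: "Q = cls m' G" "1 \<le> m'" "G \<in> maps m'"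
      and S: "S = cls k K" "1 \<le> k" "K \<in> maps k"
      unfolding pi_set_eq by blast
    have "pi_mult n X \<V> A pt (pi_mult n X \<V> A pt P Q) S = cls (m + m' + k) (star 1 (m + m') (star 1 m F G) K)"
      using P Q S star_maps[OF d] by (simp add: pi_mult_cls[OF d])
    also have "\<dots> = pi_mult n X \<V> A pt P (pi_mult n X \<V> A pt Q S)"
      using P Q S star_maps[OF d] by (simp add: pi_mult_cls[OF d] star_assoc add.assoc)
    finally show "pi_mult n X \<V> A pt (pi_mult n X \<V> A pt P Q) S =
      pi_mult n X \<V> A pt P (pi_mult n X \<V> A pt Q S)" .
  next
    fix P assume "P \<in> pi_set n X \<V> A pt"
    then obtain m F where P: "P = cls m F" "1 \<le> m" "F \<in> maps m"
      unfolding pi_set_eq by blast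
    have "pi_mult n X \<V> A pt ?one P = cls (1 + m) (shift 1 1 F)"
      unfolding P(1) pi_mult_cls[OF d order.refl P(2) const_maps P(3)] star_const[OF d P(3)] ..
    also have "\<dots> = cls m F"
    proof -
      have sm: "shift 1 1 F \<in> maps (m + 1)" using shift_maps[OF d P(3)] .
      then show ?thesis
        using cls_eq_iff[of "1 + m" "shift 1 1 F" m F] htpI[OF _ sm shift_steps[OF d P(3)]] P
        by (simp add: add.commute)
    qed
    finally show "pi_mult n X \<V> A pt ?one P = P" using P(1) by simp
  next
    fix P assume "P \<in> pi_set n X \<V> A pt"
    then obtain m F where P: "P = cls m F" "1 \<le> m" "F \<in> maps m"
      unfolding pi_set_eq by blast
    \<comment> \<open>The inverse is the reflected map. Followed by \<open>F\<close> it reads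
      \<open>F\<close> along \<open>\<bar>t - int m\<bar>\<close>.\<close>
    let ?F = "reparam 1 (\<lambda>t. int m - t) F"
    have F': "?F \<in> maps m" by (rule reparam_maps[OF d P(3)]) (auto simp: lip_def)
    have "star 1 m ?F F x = reparam 1 (\<lambda>t. \<bar>t - int m\<bar>) F x" for x
      by (auto simp: star_def shift_def reparam_def)
    then have "star 1 m ?F F = reparam 1 (\<lambda>t. \<bar>t - int m\<bar>) F" by blast
    \<comment> \<open>The upper end of the interpolation never drops below \<open>m\<close>, so it
      evaluates \<open>F\<close> only where it is \<open>pt\<close>. It meets the lower end outside
      the slab from 0 to \<open>m + m\<close>.\<close>
    moreover have "(\<lambda>_. pt) x = reparam 1 (\<lambda>t. max (int m) \<bar>t - int m\<bar>) F x" for x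
      using maps_dir[OF P(3) d] by (simp add: reparam_def)
    then have "(\<lambda>_. pt) = reparam 1 (\<lambda>t. max (int m) \<bar>t - int m\<bar>) F" by blast
    moreover have "(step (m + m))\<^sup>*\<^sup>* (reparam 1 (\<lambda>t. \<bar>t - int m\<bar>) F)
        (reparam 1 (\<lambda>t. max (int m) \<bar>t - int m\<bar>) F)"
      by (rule reparam_steps[OF d P(3)]) (auto simp: lip_def)
    ultimately have "htp (star 1 m ?F F) (\<lambda>_. pt)"
      using star_maps[OF d F' P(3,2)] P(2) by (intro htpI[of "m + m"]) auto
    then have "cls (m + m) (star 1 m ?F F) = ?one"
      using cls_eq_iff star_maps[OF d F' P(3,2)] P(2) const_maps by simp
    then have "pi_mult n X \<V> A pt (cls m ?F) P = ?one"
      using pi_mult_cls[OF d P(2,2) F' P(3)] P(1) by simp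
    moreover have "cls m ?F \<in> pi_set n X \<V> A pt" unfolding pi_set_eq using F' P(2) by blast
    ultimately show "\<exists>Q\<in>pi_set n X \<V> A pt. pi_mult n X \<V> A pt Q P = ?one" by blast
  qed
qed

lemma comm_group_rel_pi_sc:
  assumes d: "dir 1" "dir 2"
  shows "comm_group (rel_pi_sc n X \<V> A pt)"
proof (rule group.group_comm_groupI[OF group_rel_pi_sc[OF d(1)]])
  fix P Q assume "P \<in> carrier (rel_pi_sc n X \<V> A pt)" "Q \<in> carrier (rel_pi_sc n X \<V> A pt)"
  then obtain m F m' G where
    P: "P = cls m F" "1 \<le> m" "F \<in> maps m" and Q: "Q = cls m' G" "1 \<le> m'" "G \<in> maps m'"
    unfolding rel_pi_sc_def by (auto simp: pi_set_eq)
  \<comment> \<open>\<open>star_comm\<close> takes factors of equal size; enlarging a cube does not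
    change the class.\<close>
  define l where "l = max m m'"
  have l: "1 \<le> l" "F \<in> maps l" "G \<in> maps l"
    using P Q maps_mono[of m l] maps_mono[of m' l] by (auto simp: l_def)
  have "P = cls l F" "Q = cls l G"
    using P Q l cls_eq_iff htp_refl by auto
  moreover have "cls (l + l) (star 1 l F G) = cls (l + l) (star 1 l G F)"
    using cls_eq_iff star_maps[OF d(1)] star_comm[OF d _ l] l by simp
  ultimately show "P \<otimes>\<^bsub>rel_pi_sc n X \<V> A pt\<^esub> Q = Q \<otimes>\<^bsub>rel_pi_sc n X \<V> A pt\<^esub> P"
    using l pi_mult_cls[OF d(1)] by (simp add: rel_pi_sc_def)
qed

end

theorem theorem3p2p18:
  fixes X :: "'a set" and \<V> :: "('a \<times> 'a) set set" and A :: "'a set" and pt :: 'a and n :: nat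
  assumes "semi_coarse_space X \<V>" and "A \<subseteq> X" and "pt \<in> A"
  shows "(1 \<le> n \<longrightarrow> group (pi_sc n X \<V> pt)) \<and>
         (2 \<le> n \<longrightarrow> comm_group (pi_sc n X \<V> pt)) \<and>
         (2 \<le> n \<longrightarrow> group (rel_pi_sc n X \<V> A pt)) \<and>
         (3 \<le> n \<longrightarrow> comm_group (rel_pi_sc n X \<V> A pt))"
proof -
  have pair: "semi_coarse_pair X \<V> B pt n" if "1 \<le> n" "B = {pt} \<or> B = A" for B
    using that assms by (auto simp: semi_coarse_pair_def semi_coarse_pair_axioms_def)
  have dir: "semi_coarse_pair.dir B pt n d \<longleftrightarrow> d \<in> {1..n} \<and> (d \<noteq> n \<or> B = {pt})"
    if "1 \<le> n" "B = {pt} \<or> B = A" for B d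
    by (rule semi_coarse_pair.dir_def[OF pair[OF that]])
  show ?thesis unfolding pi_sc_def
    \<comment> \<open>For \<open>B = {pt}\<close> all directions up to \<open>n\<close> qualify; for
      \<open>B = A\<close> the bounds on \<open>n\<close> place direction 1, respectively 1 and 2,
      strictly below \<open>n\<close>.\<close>
    by (intro conjI impI semi_coarse_pair.group_rel_pi_sc[OF pair]
        semi_coarse_pair.comm_group_rel_pi_sc[OF pair]) (auto simp: dir)
qed

end
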